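(* Let $H(x,u)=\sum_{n\ge0}\sum_{k\ge0} h_{n,k}x^nu^k$, where $h_{n,k}$ is the number of permutations $\sigma\in\mathcal{S}^2_n(321)$ with $\operatorname{lif}(\sigma)=k$ (so $h_{0,0}=1$ counts the empty forest). Then $H$ satisfies $$H(x,u)=1+\frac{xu}{1-u}\Bigg(\frac{u^2(1-3u+2u^2-u^3)}{(1-u)^2}H(x,u)+\frac{1-3u+3u^2-u^3+u^4}{(1-u)^2}H(x,1)+\frac{2-2u-u^2}{1-u}\frac{\partial H}{\partial u}(x,1)+\frac12\frac{\partial^2H}{\partial u^2}(x,1)\Bigg).$$
   Context: $\mathcal{S}^2_n(321)$ denotes the set of permutations $\pi\in\mathcal{S}_{3n}$ that avoid $321$ (no indices $a<b<c$ with $\pi_a>\pi_b>\pi_c$) and satisfy $\pi_{3i+1}<\pi_{3i+2}$ and $\pi_{3i+1}<\pi_{3i+3}$ for all $0\le i<n$ (permutations of $321$-avoiding binary shrub forests with $n$ shrubs). For a permutation $\pi$ of length $N$: if $\pi$ is the identity $12\cdots N$ then $\operatorname{lif}(\pi)=N$; otherwise let $\pi(i)$ be the rightmost entry of $\pi$ that is not a left-to-right maximum (equivalently, the smaller entry of the rightmost inversion), and set $\operatorname{lif}(\pi)=N-\pi(i)$, the number of entries larger than it. *)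

theory Defs
  imports
    "HOL-Combinatorics.Permutations"
    "HOL-Computational_Algebra.Computational_Algebra"
begin

text \<open>
  A permutation of length \<open>N\<close> is a function \<open>\<pi>\<close> with \<open>\<pi> permutes {1..N}\<close>;
  its one-line notation is \<open>\<pi> 1, \<dots>, \<pi> N\<close>.
\<close>

definition avoids_321 :: "nat \<Rightarrow> (nat \<Rightarrow> nat) \<Rightarrow> bool" where
  "avoids_321 N \<pi> \<longleftrightarrow>
     \<not> (\<exists>a b c. 1 \<le> a \<and> a < b \<and> b < c \<and> c \<le> N \<and> \<pi> a > \<pi> b \<and> \<pi> b > \<pi> c)"

definition shrub_perms_321 :: "nat \<Rightarrow> (nat \<Rightarrow> nat) set" where
  "shrub_perms_321 n =
     {\<pi>. \<pi> permutes {1..3 * n} \<and> avoids_321 (3 * n) \<pi> \<and>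
         (\<forall>i<n. \<pi> (3 * i + 1) < \<pi> (3 * i + 2) \<and> \<pi> (3 * i + 1) < \<pi> (3 * i + 3))}"

definition left_to_right_max :: "(nat \<Rightarrow> nat) \<Rightarrow> nat \<Rightarrow> bool" where
  "left_to_right_max \<pi> i \<longleftrightarrow> (\<forall>j. 1 \<le> j \<and> j < i \<longrightarrow> \<pi> j < \<pi> i)"

text \<open>
  A permutation of \<open>{1..N}\<close> fixes everything outside \<open>{1..N}\<close>, so it is the identity
  permutation iff it equals \<open>id\<close>.  In the other case the set below is nonempty.
\<close>

definition lif :: "nat \<Rightarrow> (nat \<Rightarrow> nat) \<Rightarrow> nat" where
  "lif N \<pi> =
     (if \<pi> = id then N
      else N - \<pi> (Max {i \<in> {1..N}. \<not> left_to_right_max \<pi> i}))"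

definition shrub_count :: "nat \<Rightarrow> nat \<Rightarrow> nat" where
  "shrub_count n k = card {\<sigma> \<in> shrub_perms_321 n. lif (3 * n) \<sigma> = k}"

lemma lif_le: "lif N \<pi> \<le> N"
  by (simp add: lif_def)

lemma shrub_count_eq_0: "k > 3 * n \<Longrightarrow> shrub_count n k = 0"
proof -
  assume "k > 3 * n"
  then have "{\<sigma> \<in> shrub_perms_321 n. lif (3 * n) \<sigma> = k} = {}"
    using lif_le[of "3 * n"] not_less by blast
  then show ?thesis
    unfolding shrub_count_def by (simp only: card.empty)
qed

text \<open>
  The generating function as a power series in \<open>x\<close> whose coefficients are polynomials in
  \<open>u\<close>: the statistic is at most \<open>3 * n\<close>, so truncating the inner sum there loses nothing.
\<close>

definition shrub_gf :: "rat poly fps" where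
  "shrub_gf = Abs_fps (\<lambda>n. \<Sum>k\<le>3 * n. monom (of_nat (shrub_count n k)) k)"

lemma coeff_shrub_gf: "coeff (fps_nth shrub_gf n) k = of_nat (shrub_count n k)"
proof -
  have "coeff (fps_nth shrub_gf n) k = (\<Sum>j\<le>3 * n. if j = k then of_nat (shrub_count n j) else 0)"
    by (simp add: shrub_gf_def coeff_sum)
  also have "\<dots> = of_nat (shrub_count n k)"
    using shrub_count_eq_0[of n k] by (simp add: sum.delta)
  finally show ?thesis .
qed

definition fps_map :: "('a \<Rightarrow> 'b) \<Rightarrow> 'a fps \<Rightarrow> 'b fps" where
  "fps_map f F = Abs_fps (\<lambda>n. f (fps_nth F n))"

text \<open>The partial derivative in \<open>u\<close>, and the substitution \<open>u = 1\<close> (a constant in \<open>u\<close>).\<close>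

definition deriv_u :: "rat poly fps \<Rightarrow> rat poly fps" where
  "deriv_u = fps_map pderiv"

definition at_u_1 :: "rat poly fps \<Rightarrow> rat poly fps" where
  "at_u_1 = fps_map (\<lambda>p. [:poly p 1:])"

text \<open>
  Because of the denominators \<open>1 - u\<close>, identities are stated among power series in \<open>x\<close>
  over the field of rational functions in \<open>u\<close>, into which the power series in \<open>x\<close>
  with polynomial coefficients embed coefficientwise.
\<close>

definition to_ratfun :: "rat poly fps \<Rightarrow> rat poly fract fps" where
  "to_ratfun = fps_map to_fract"

definition var_u :: "rat poly fract" where
  "var_u = to_fract [:0, 1:]"

end

theory Submission
  imports Defs
begin

text \<open>
  In a \<open>321\<close>-avoiding permutation the entries that are not left-to-right maxima increase, so the
  last of them is the largest.  Hence a new last entry with exactly \<open>j\<close> larger entries keeps the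
  permutation \<open>321\<close>-avoiding iff \<open>j\<close> is at most the statistic \<open>k\<close> (\<open>lif\<close>), and the statistic
  becomes \<open>j\<close>, or \<open>k + 1\<close> if \<open>j = 0\<close>.  A shrub is appended by three such steps \<open>a, b, c\<close>; its
  order constraints read \<open>b \<le> a\<close> and \<open>c \<le> a + 1\<close>.  The generating polynomial of the statistics
  reachable from \<open>k\<close> is an iterated geometric sum, and its closed form is the kernel on the
  right-hand side of the functional equation, with \<open>u\<^sup>k\<close>, \<open>1\<close>, \<open>k\<close> and \<open>k (k - 1)\<close> in place of
  \<open>H(x,u)\<close>, \<open>H(x,1)\<close> and the first and second derivatives at \<open>u = 1\<close>.
\<close>

section \<open>Appending a last entry with a prescribed number of larger entries\<close>

text \<open>For \<open>1 \<le> v \<le> Suc N\<close> this is the cycle \<open>v\<close>,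
  \<open>v + 1\<close>, ..., \<open>Suc N\<close>, back to \<open>v\<close>. Composed after a
  permutation fixing \<open>Suc N\<close>, it makes room for the value \<open>v\<close> at the end;
  being a permutation itself, it can be undone.\<close>

definition shift_above :: "nat \<Rightarrow> nat \<Rightarrow> nat \<Rightarrow> nat" where
  "shift_above N v x = (if x = Suc N then v else if v \<le> x \<and> x \<le> N then Suc x else x)"

text \<open>The last entry of \<open>append_below N j \<sigma>\<close> has exactly \<open>j\<close> larger entries.\<close>

definition append_below :: "nat \<Rightarrow> nat \<Rightarrow> (nat \<Rightarrow> nat) \<Rightarrow> nat \<Rightarrow> nat" where
  "append_below N j \<sigma> = shift_above N (Suc N - j) \<circ> \<sigma>"

lemma shift_above_permutes:
  assumes "1 \<le> v" "v \<le> Suc N"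
  shows "shift_above N v permutes {1..Suc N}"
proof (rule bij_imp_permutes)
  have inj: "inj_on (shift_above N v) {1..Suc N}"
    using assms by (auto simp: inj_on_def shift_above_def split: if_splits)
  have "shift_above N v ` {1..Suc N} \<subseteq> {1..Suc N}"
    using assms by (auto simp: shift_above_def)
  with inj show "bij_betw (shift_above N v) {1..Suc N} {1..Suc N}"
    by (simp add: bij_betw_def endo_inj_surj)
  show "shift_above N v x = x" if "x \<notin> {1..Suc N}" for x
    using that assms by (auto simp: shift_above_def)
qed

lemma append_below_permutes:
  assumes "\<sigma> permutes {1..N}" "j \<le> N"
  shows "append_below N j \<sigma> permutes {1..Suc N}"
proof -
  have "\<sigma> permutes {1..Suc N}"
    using assms(1) by (rule permutes_subset) auto
  then show ?thesis
    unfolding append_below_def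
    using assms(2) by (intro permutes_compose shift_above_permutes) auto
qed

lemma permutes_interval_bounds:
  fixes \<sigma> :: "nat \<Rightarrow> nat"
  assumes "\<sigma> permutes {1..N}" "1 \<le> a" "a \<le> N"
  shows "1 \<le> \<sigma> a" "\<sigma> a \<le> N"
  using permutes_in_image[OF assms(1), of a] assms(2,3) by auto

lemma append_below_last:
  assumes "\<sigma> permutes {1..N}"
  shows "append_below N j \<sigma> (Suc N) = Suc N - j"
proof -
  have "\<sigma> (Suc N) = Suc N"
    using assms by (rule permutes_not_in) simp
  then show ?thesis
    by (simp add: append_below_def shift_above_def)
qed

lemma append_below_apply:
  assumes "\<sigma> permutes {1..N}" "1 \<le> a" "a \<le> N"
  shows "append_below N j \<sigma> a = (if \<sigma> a \<le> N - j then \<sigma> a else Suc (\<sigma> a))"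
  using permutes_interval_bounds[OF assms]
  by (auto simp: append_below_def shift_above_def)

lemma append_below_less_iff:
  assumes "\<sigma> permutes {1..N}" "1 \<le> a" "a \<le> N" "1 \<le> b" "b \<le> N"
  shows "append_below N j \<sigma> a < append_below N j \<sigma> b \<longleftrightarrow> \<sigma> a < \<sigma> b"
  using append_below_apply[OF assms(1-3)] append_below_apply[OF assms(1,4,5)] by auto

lemma append_below_less_last_iff:
  assumes "\<sigma> permutes {1..N}" "1 \<le> a" "a \<le> N" "j \<le> N"
  shows "append_below N j \<sigma> a < append_below N j \<sigma> (Suc N) \<longleftrightarrow> \<sigma> a \<le> N - j"
  using append_below_apply[OF assms(1-3)] append_below_last[OF assms(1)] assms(4) by auto

lemma append_below_last_less_iff:
  assumes "\<sigma> permutes {1..N}" "1 \<le> a" "a \<le> N" "j \<le> N"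
  shows "append_below N j \<sigma> (Suc N) < append_below N j \<sigma> a \<longleftrightarrow> N - j < \<sigma> a"
  using append_below_apply[OF assms(1-3)] append_below_last[OF assms(1)] assms(4) by auto

lemma append_below_inject:
  assumes "\<sigma> permutes {1..N}" "\<tau> permutes {1..N}" "j \<le> N" "i \<le> N"
    and eq: "append_below N j \<sigma> = append_below N i \<tau>"
  shows "j = i \<and> \<sigma> = \<tau>"
proof -
  have ji: "j = i"
    using append_below_last[OF assms(1), of j] append_below_last[OF assms(2), of i] eq assms(3,4)
    by simp
  have "inj (shift_above N (Suc N - j))"
    using assms(3) by (intro permutes_inj[OF shift_above_permutes]) auto
  then have "\<sigma> = \<tau>"
    using eq unfolding append_below_def ji by (metis fun.inj_map_strong inj_eq)
  with ji show ?thesis by simp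
qed

text \<open>The last value dictates \<open>j\<close>. Undoing the corresponding cycle makes
  \<open>Suc N\<close> a fixed point, so what remains permutes \<open>{1..N}\<close>.\<close>

lemma append_below_surj:
  assumes \<pi>: "\<pi> permutes {1..Suc N}"
  obtains \<sigma> j where "\<sigma> permutes {1..N}" "j \<le> N" "\<pi> = append_below N j \<sigma>"
proof
  define j where "j = Suc N - \<pi> (Suc N)"
  have bounds: "1 \<le> \<pi> (Suc N)" "\<pi> (Suc N) \<le> Suc N"
    using permutes_interval_bounds[OF \<pi>, of "Suc N"] by auto
  then show "j \<le> N"
    by (auto simp: j_def)
  define c where "c = shift_above N (Suc N - j)"
  have c: "c permutes {1..Suc N}"
    unfolding c_def using \<open>j \<le> N\<close> by (intro shift_above_permutes) auto
  have "c (Suc N) = \<pi> (Suc N)"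
    using bounds by (simp add: c_def shift_above_def j_def)
  then have last: "(inv c \<circ> \<pi>) (Suc N) = Suc N"
    using permutes_inverses(2)[OF c, of "Suc N"] by simp
  have "inv c \<circ> \<pi> permutes {1..Suc N}"
    by (intro permutes_compose \<pi> permutes_inv c)
  then show "inv c \<circ> \<pi> permutes {1..N}"
    by (rule permutes_superset) (use last in \<open>auto simp: le_Suc_eq\<close>)
  show "\<pi> = append_below N j (inv c \<circ> \<pi>)"
    unfolding append_below_def c_def[symmetric]
    using permutes_inverses(1)[OF c] by (simp add: fun_eq_iff)
qed

section \<open>Non-maxima and the statistic\<close>

definition nonmax :: "nat \<Rightarrow> (nat \<Rightarrow> nat) \<Rightarrow> nat set" where
  "nonmax N \<sigma> = {i \<in> {1..N}. \<not> left_to_right_max \<sigma> i}"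

text \<open>Injectivity excludes equal values, so failing to be a left-to-right maximum means being
  the smaller entry of an inversion.\<close>

lemma nonmax_iff:
  assumes "\<sigma> permutes {1..N}"
  shows "c \<in> nonmax N \<sigma> \<longleftrightarrow> (\<exists>b. 1 \<le> b \<and> b < c \<and> c \<le> N \<and> \<sigma> c < \<sigma> b)"
  using permutes_inj[OF assms]
  by (force simp: nonmax_def left_to_right_max_def inj_eq not_less le_less)

lemma finite_nonmax: "finite (nonmax N \<sigma>)"
  by (simp add: nonmax_def)

lemma nonmax_empty_iff:
  assumes \<sigma>: "\<sigma> permutes {1..N}"
  shows "nonmax N \<sigma> = {} \<longleftrightarrow> \<sigma> = id"
proof
  assume "nonmax N \<sigma> = {}"
  \<comment> \<open>Without non-maxima the values increase strictly, hence
    \<open>\<sigma> a \<ge> a\<close> everywhere, which only the identity satisfies.\<close>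
  then have less: "\<sigma> a < \<sigma> b" if "1 \<le> a" "a < b" "b \<le> N" for a b
    using that by (auto simp: nonmax_def left_to_right_max_def)
  have ge: "\<sigma> a \<ge> a" if "1 \<le> a" "a \<le> N" for a
    using that
  proof (induction a)
    case (Suc a)
    show ?case
    proof (cases "a = 0")
      case True
      then show ?thesis using permutes_interval_bounds[OF \<sigma>, of 1] Suc.prems by auto
    next
      case False
      then show ?thesis using Suc less[of a "Suc a"] by auto
    qed
  qed simp
  have "\<sigma> x \<ge> x" for x
    using ge[of x] permutes_not_in[OF \<sigma>, of x] by (cases "x \<in> {1..N}") auto
  then show "\<sigma> = id"
    using permutes_natset_ge[OF \<sigma>] by auto
qed (auto simp: nonmax_def left_to_right_max_def)

lemma lif_nonid:
  assumes "\<sigma> \<noteq> id"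
  shows "lif N \<sigma> = N - \<sigma> (Max (nonmax N \<sigma>))"
  using assms by (simp add: lif_def nonmax_def)

text \<open>\<open>lif\<close> reads only the last non-maximum \<open>m\<close>. Its value is the
  largest among the non-maxima: a larger one at \<open>c < m\<close>, an earlier entry above it, and
  \<open>m\<close> would form a 321. So bounding \<open>\<sigma> m\<close> bounds them all; for the
  identity both sides hold.\<close>

lemma le_lif_iff:
  assumes \<sigma>: "\<sigma> permutes {1..N}" and av: "avoids_321 N \<sigma>" and "j \<le> N"
  shows "j \<le> lif N \<sigma> \<longleftrightarrow> (\<forall>c\<in>nonmax N \<sigma>. \<sigma> c \<le> N - j)"
proof (cases "\<sigma> = id")
  case True
  with \<open>j \<le> N\<close> show ?thesis
    using nonmax_empty_iff[OF \<sigma>] by (simp add: lif_def)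
next
  case False
  define m where "m = Max (nonmax N \<sigma>)"
  have m: "m \<in> nonmax N \<sigma>"
    unfolding m_def using False nonmax_empty_iff[OF \<sigma>] by (intro Max_in finite_nonmax) auto
  then have bound: "\<sigma> m \<le> N"
    using permutes_interval_bounds[OF \<sigma>, of m] by (auto simp: nonmax_def)
  have "\<sigma> c \<le> \<sigma> m" if c: "c \<in> nonmax N \<sigma>" for c
  proof (rule ccontr)
    assume less: "\<not> \<sigma> c \<le> \<sigma> m"
    have "c \<le> m"
      unfolding m_def using c by (intro Max_ge finite_nonmax)
    with less have "c < m" by (cases "c = m") auto
    moreover obtain b where "1 \<le> b" "b < c" "\<sigma> c < \<sigma> b"
      using c nonmax_iff[OF \<sigma>] by blast
    moreover have "m \<le> N" using m by (simp add: nonmax_def)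
    ultimately show False
      using av less unfolding avoids_321_def by (meson not_le)
  qed
  then have "(\<forall>c\<in>nonmax N \<sigma>. \<sigma> c \<le> N - j) \<longleftrightarrow> \<sigma> m \<le> N - j"
    using m by (meson le_trans)
  then show ?thesis
    using lif_nonid[OF False, of N] bound \<open>j \<le> N\<close> unfolding m_def by auto
qed

section \<open>Effect of one appended entry on 321-avoidance and on the statistic\<close>

text \<open>A 321 either lies among the old entries, whose relative order is kept, or ends at the
  new entry. In the second case its middle entry is a non-maximum of value above
  \<open>N - j\<close>, the situation that \<open>le_lif_iff\<close> controls.\<close>

lemma avoids_321_append_below_iff:
  assumes \<sigma>: "\<sigma> permutes {1..N}" and j: "j \<le> N"
  shows "avoids_321 (Suc N) (append_below N j \<sigma>) \<longleftrightarrow> avoids_321 N \<sigma> \<and> j \<le> lif N \<sigma>"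
proof -
  let ?\<tau> = "append_below N j \<sigma>"
  have "\<not> avoids_321 (Suc N) ?\<tau> \<longleftrightarrow>
      (\<exists>a b c. 1 \<le> a \<and> a < b \<and> b < c \<and> c \<le> N \<and> ?\<tau> b < ?\<tau> a \<and> ?\<tau> c < ?\<tau> b) \<or>
      (\<exists>a b. 1 \<le> a \<and> a < b \<and> b \<le> N \<and> ?\<tau> b < ?\<tau> a \<and> ?\<tau> (Suc N) < ?\<tau> b)"
    (is "?l \<longleftrightarrow> ?r")
  proof
    assume ?l
    then obtain a b c where abc: "1 \<le> a" "a < b" "b < c" "c \<le> Suc N" "?\<tau> b < ?\<tau> a" "?\<tau> c < ?\<tau> b"
      unfolding avoids_321_def by blast
    show ?r
    proof (cases "c = Suc N")
      case True
      with abc have "b \<le> N" by simp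
      with abc True show ?thesis by blast
    next
      case False
      with abc have "c \<le> N" by simp
      with abc show ?thesis by blast
    qed
  next
    assume ?r
    then show ?l
      unfolding avoids_321_def by (metis le_SucI le_imp_less_Suc order_refl)
  qed
  also have "\<dots> \<longleftrightarrow> \<not> avoids_321 N \<sigma> \<or> (\<exists>a b. 1 \<le> a \<and> a < b \<and> b \<le> N \<and> \<sigma> b < \<sigma> a \<and> N - j < \<sigma> b)"
  proof (intro arg_cong2[where f = "(\<or>)"])
    show "(\<exists>a b c. 1 \<le> a \<and> a < b \<and> b < c \<and> c \<le> N \<and> ?\<tau> b < ?\<tau> a \<and> ?\<tau> c < ?\<tau> b) = (\<not> avoids_321 N \<sigma>)"
      unfolding avoids_321_def not_not
      by (intro ex_cong1 conj_cong refl append_below_less_iff[OF \<sigma>]) auto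
    show "(\<exists>a b. 1 \<le> a \<and> a < b \<and> b \<le> N \<and> ?\<tau> b < ?\<tau> a \<and> ?\<tau> (Suc N) < ?\<tau> b) =
        (\<exists>a b. 1 \<le> a \<and> a < b \<and> b \<le> N \<and> \<sigma> b < \<sigma> a \<and> N - j < \<sigma> b)"
      by (intro ex_cong1 conj_cong refl append_below_less_iff[OF \<sigma>]
            append_below_last_less_iff[OF \<sigma>] j) auto
  qed
  also have "\<dots> \<longleftrightarrow> \<not> (avoids_321 N \<sigma> \<and> (\<forall>c\<in>nonmax N \<sigma>. \<sigma> c \<le> N - j))"
    unfolding Ball_def nonmax_iff[OF \<sigma>] by (auto simp: not_le)
  finally show ?thesis
    using le_lif_iff[OF \<sigma> _ j] by blast
qed

definition lif_step :: "nat \<Rightarrow> nat \<Rightarrow> nat" where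
  "lif_step k j = (if j = 0 then Suc k else j)"

text \<open>For \<open>j = 0\<close> the new entry is the maximum: the last non-maximum stays and
  gains one larger entry, and the identity stays the identity. For \<open>j > 0\<close> the new
  entry is itself the rightmost non-maximum.\<close>

lemma lif_append_below:
  assumes \<sigma>: "\<sigma> permutes {1..N}" and j: "j \<le> N"
  shows "lif (Suc N) (append_below N j \<sigma>) = lif_step (lif N \<sigma>) j"
proof (cases "j = 0")
  case True
  have app: "append_below N 0 \<sigma> = \<sigma>"
    by (auto simp: append_below_def shift_above_def)
  show ?thesis
  proof (cases "\<sigma> = id")
    case id: True
    then show ?thesis using True app by (simp add: lif_def lif_step_def)
  next
    case False
    define m where "m = Max (nonmax N \<sigma>)"
    have "m \<in> nonmax N \<sigma>"
      unfolding m_def using False nonmax_empty_iff[OF \<sigma>] by (intro Max_in finite_nonmax) auto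
    then have bound: "\<sigma> m \<le> N"
      using permutes_interval_bounds[OF \<sigma>, of m] by (auto simp: nonmax_def)
    have "left_to_right_max \<sigma> (Suc N)"
      using permutes_interval_bounds[OF \<sigma>] permutes_not_in[OF \<sigma>, of "Suc N"]
      by (auto simp: left_to_right_max_def less_Suc_eq_le)
    then have "nonmax (Suc N) \<sigma> = nonmax N \<sigma>"
      by (auto simp: nonmax_def le_Suc_eq)
    then show ?thesis
      using True app False bound by (simp add: lif_nonid lif_step_def m_def Suc_diff_le)
  qed
next
  case False
  let ?\<tau> = "append_below N j \<sigma>"
  have \<tau>: "?\<tau> permutes {1..Suc N}"
    using \<sigma> j by (rule append_below_permutes)
  have last: "?\<tau> (Suc N) = Suc N - j"
    using \<sigma> by (rule append_below_last)
  have "?\<tau> \<noteq> id"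
    using last False j by auto
  have "Suc N \<in> nonmax (Suc N) ?\<tau>"
  proof (rule ccontr)
    assume *: "Suc N \<notin> nonmax (Suc N) ?\<tau>"
    \<comment> \<open>As a left-to-right maximum the last entry would bound all values, yet the
      value \<open>Suc N\<close> is attained and exceeds \<open>Suc N - j\<close>.\<close>
    have bound: "?\<tau> i \<le> Suc N - j" if "1 \<le> i" "i \<le> Suc N" for i
    proof (cases "i = Suc N")
      case False
      then show ?thesis
        using that * last by (auto simp: nonmax_def left_to_right_max_def intro!: less_imp_le)
    qed (simp add: last)
    obtain i where "?\<tau> i = Suc N"
      using permutes_surj[OF \<tau>] by (metis surjD)
    then show False
      using bound[of i] False permutes_not_in[OF \<tau>, of i] j by (cases "i \<in> {1..Suc N}") auto
  qed
  then have "Max (nonmax (Suc N) ?\<tau>) = Suc N"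
    by (intro Max_eqI finite_nonmax) (auto simp: nonmax_def)
  then show ?thesis
    using \<open>?\<tau> \<noteq> id\<close> last False j by (simp add: lif_nonid lif_step_def)
qed

section \<open>Appending a whole shrub\<close>

text \<open>
  The bound \<open>b \<le> lif_step k a\<close> that \<open>321\<close>-avoidance puts on the second step is implied by \<open>b \<le> a\<close>.
\<close>

definition shrub_choices :: "nat \<Rightarrow> (nat \<times> nat \<times> nat) set" where
  "shrub_choices k =
     (SIGMA a:{..k}. SIGMA b:{..a}. {..min (Suc a) (lif_step (lif_step k a) b)})"

definition append_shrub :: "nat \<Rightarrow> (nat \<Rightarrow> nat) \<times> nat \<times> nat \<times> nat \<Rightarrow> nat \<Rightarrow> nat" where
  "append_shrub N = (\<lambda>(\<sigma>, a, b, c).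
     append_below (Suc (Suc N)) c (append_below (Suc N) b (append_below N a \<sigma>)))"

definition shrub_lif :: "nat \<Rightarrow> nat \<times> nat \<times> nat \<Rightarrow> nat" where
  "shrub_lif k = (\<lambda>(a, b, c). lif_step (lif_step (lif_step k a) b) c)"

lemma shrub_choices_iff:
  "(a, b, c) \<in> shrub_choices k \<longleftrightarrow>
     a \<le> k \<and> b \<le> a \<and> c \<le> Suc a \<and> c \<le> lif_step (lif_step k a) b"
  by (auto simp: shrub_choices_def)

lemma finite_shrub_choices: "finite (shrub_choices k)"
  by (auto simp: shrub_choices_def)

text \<open>Once appended, the root has \<open>a\<close> larger entries, so the first leaf lies
  above it iff \<open>b \<le> a\<close>. The root then has \<open>a + 1\<close> larger entries,
  whence the bound \<open>Suc a\<close> for the second leaf.\<close>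

lemma
  assumes \<sigma>: "\<sigma> permutes {1..N}" and abc: "a \<le> N" "b \<le> Suc N" "c \<le> Suc (Suc N)"
  shows append_shrub_permutes:
      "append_shrub N (\<sigma>, a, b, c) permutes {1..N + 3}"
    and append_shrub_less_iff: "\<And>i j. 1 \<le> i \<Longrightarrow> i \<le> N \<Longrightarrow> 1 \<le> j \<Longrightarrow> j \<le> N \<Longrightarrow>
      append_shrub N (\<sigma>, a, b, c) i < append_shrub N (\<sigma>, a, b, c) j \<longleftrightarrow> \<sigma> i < \<sigma> j"
    and append_shrub_root_less_fst:
      "append_shrub N (\<sigma>, a, b, c) (N + 1) < append_shrub N (\<sigma>, a, b, c) (N + 2) \<longleftrightarrow> b \<le> a"
    and append_shrub_root_less_snd:
      "b \<le> a \<Longrightarrow> append_shrub N (\<sigma>, a, b, c) (N + 1) < append_shrub N (\<sigma>, a, b, c) (N + 3) \<longleftrightarrow> c \<le> Suc a"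
    and avoids_321_append_shrub_iff:
      "avoids_321 (N + 3) (append_shrub N (\<sigma>, a, b, c)) \<longleftrightarrow> avoids_321 N \<sigma> \<and> a \<le> lif N \<sigma> \<and>
         b \<le> lif_step (lif N \<sigma>) a \<and> c \<le> lif_step (lif_step (lif N \<sigma>) a) b"
    and lif_append_shrub:
      "lif (N + 3) (append_shrub N (\<sigma>, a, b, c)) = shrub_lif (lif N \<sigma>) (a, b, c)"
proof -
  define \<tau> where "\<tau> = append_below N a \<sigma>"
  define \<rho> where "\<rho> = append_below (Suc N) b \<tau>"
  have app: "append_shrub N (\<sigma>, a, b, c) = append_below (Suc (Suc N)) c \<rho>"
    by (simp add: append_shrub_def \<rho>_def \<tau>_def)
  have \<tau>: "\<tau> permutes {1..Suc N}"
    unfolding \<tau>_def using \<sigma> abc by (intro append_below_permutes)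
  have \<rho>: "\<rho> permutes {1..Suc (Suc N)}"
    unfolding \<rho>_def using \<tau> abc by (intro append_below_permutes)
  have N3: "N + 3 = Suc (Suc (Suc N))" "N + 2 = Suc (Suc N)" "N + 1 = Suc N"
    by simp_all
  show "append_shrub N (\<sigma>, a, b, c) permutes {1..N + 3}"
    unfolding app N3 using \<rho> abc by (intro append_below_permutes)
  show "append_shrub N (\<sigma>, a, b, c) i < append_shrub N (\<sigma>, a, b, c) j \<longleftrightarrow> \<sigma> i < \<sigma> j"
    if "1 \<le> i" "i \<le> N" "1 \<le> j" "j \<le> N" for i j
  proof -
    have "append_below (Suc (Suc N)) c \<rho> i < append_below (Suc (Suc N)) c \<rho> j \<longleftrightarrow> \<rho> i < \<rho> j"
      using that by (intro append_below_less_iff[OF \<rho>]) auto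
    also have "\<dots> \<longleftrightarrow> \<tau> i < \<tau> j"
      unfolding \<rho>_def using that by (intro append_below_less_iff[OF \<tau>]) auto
    also have "\<dots> \<longleftrightarrow> \<sigma> i < \<sigma> j"
      unfolding \<tau>_def using that by (intro append_below_less_iff[OF \<sigma>])
    finally show ?thesis unfolding app .
  qed
  have root: "\<tau> (Suc N) = Suc N - a"
    unfolding \<tau>_def using \<sigma> by (rule append_below_last)
  show "append_shrub N (\<sigma>, a, b, c) (N + 1) < append_shrub N (\<sigma>, a, b, c) (N + 2) \<longleftrightarrow> b \<le> a"
    unfolding app N3 using abc root append_below_less_last_iff[OF \<tau>, of "Suc N" b]
    by (auto simp: append_below_less_iff[OF \<rho>] simp flip: \<rho>_def)
  show "append_shrub N (\<sigma>, a, b, c) (N + 1) < append_shrub N (\<sigma>, a, b, c) (N + 3) \<longleftrightarrow> c \<le> Suc a"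
    if "b \<le> a"
  proof -
    \<comment> \<open>For \<open>b \<le> a\<close> the first leaf is inserted above the root, so the
      value of the root is not shifted.\<close>
    have "\<rho> (Suc N) = Suc N - a"
      unfolding \<rho>_def using append_below_apply[OF \<tau>, of "Suc N" b] root that by auto
    then show ?thesis
      unfolding app N3 using abc append_below_less_last_iff[OF \<rho>, of "Suc N" c] by auto
  qed
  show "avoids_321 (N + 3) (append_shrub N (\<sigma>, a, b, c)) \<longleftrightarrow> avoids_321 N \<sigma> \<and> a \<le> lif N \<sigma> \<and>
      b \<le> lif_step (lif N \<sigma>) a \<and> c \<le> lif_step (lif_step (lif N \<sigma>) a) b"
    unfolding app N3 avoids_321_append_below_iff[OF \<rho> abc(3)]
    unfolding \<rho>_def avoids_321_append_below_iff[OF \<tau> abc(2)] lif_append_below[OF \<tau> abc(2)]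
    unfolding \<tau>_def avoids_321_append_below_iff[OF \<sigma> abc(1)] lif_append_below[OF \<sigma> abc(1)]
    by simp
  show "lif (N + 3) (append_shrub N (\<sigma>, a, b, c)) = shrub_lif (lif N \<sigma>) (a, b, c)"
    unfolding app N3 lif_append_below[OF \<rho> abc(3)]
    unfolding \<rho>_def lif_append_below[OF \<tau> abc(2)]
    unfolding \<tau>_def lif_append_below[OF \<sigma> abc(1)]
    by (simp add: shrub_lif_def)
qed

text \<open>The three entries are peeled off from the right: \<open>c\<close>, then
  \<open>b\<close>, then \<open>a\<close>.\<close>

lemma append_shrub_inject:
  assumes "\<sigma> permutes {1..N}" "a \<le> N" "b \<le> Suc N" "c \<le> Suc (Suc N)"
    and "\<sigma>' permutes {1..N}" "a' \<le> N" "b' \<le> Suc N" "c' \<le> Suc (Suc N)"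
    and eq: "append_shrub N (\<sigma>, a, b, c) = append_shrub N (\<sigma>', a', b', c')"
  shows "(\<sigma>, a, b, c) = (\<sigma>', a', b', c')"
proof -
  let ?\<tau> = "append_below N a \<sigma>" and ?\<tau>' = "append_below N a' \<sigma>'"
  have \<tau>: "?\<tau> permutes {1..Suc N}" "?\<tau>' permutes {1..Suc N}"
    using assms by (blast intro: append_below_permutes)+
  have \<rho>: "append_below (Suc N) b ?\<tau> permutes {1..Suc (Suc N)}"
      "append_below (Suc N) b' ?\<tau>' permutes {1..Suc (Suc N)}"
    using assms \<tau> by (blast intro: append_below_permutes)+
  have 1: "c = c' \<and> append_below (Suc N) b ?\<tau> = append_below (Suc N) b' ?\<tau>'"
    by (rule append_below_inject[OF \<rho>]) (use assms in \<open>auto simp: append_shrub_def\<close>)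
  have 2: "b = b' \<and> ?\<tau> = ?\<tau>'"
    by (rule append_below_inject[OF \<tau>]) (use assms 1 in auto)
  have "a = a' \<and> \<sigma> = \<sigma>'"
    by (rule append_below_inject[OF assms(1,5)]) (use assms 2 in auto)
  with 1 2 show ?thesis by simp
qed

lemma append_shrub_surj:
  assumes "\<pi> permutes {1..N + 3}"
  obtains \<sigma> a b c where "\<sigma> permutes {1..N}" "a \<le> N" "b \<le> Suc N" "c \<le> Suc (Suc N)"
    "\<pi> = append_shrub N (\<sigma>, a, b, c)"
proof -
  have "\<pi> permutes {1..Suc (Suc (Suc N))}"
    using assms by (simp add: numeral_3_eq_3)
  then obtain \<rho> c where "\<rho> permutes {1..Suc (Suc N)}" "c \<le> Suc (Suc N)" "\<pi> = append_below (Suc (Suc N)) c \<rho>"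
    by (rule append_below_surj)
  moreover from this(1) obtain \<tau> b where "\<tau> permutes {1..Suc N}" "b \<le> Suc N" "\<rho> = append_below (Suc N) b \<tau>"
    by (rule append_below_surj)
  moreover from this(1) obtain \<sigma> a where "\<sigma> permutes {1..N}" "a \<le> N" "\<tau> = append_below N a \<sigma>"
    by (rule append_below_surj)
  ultimately show thesis
    using that by (simp add: append_shrub_def)
qed

lemma le_lif_step: "a \<le> k \<Longrightarrow> a \<le> lif_step k a"
  by (simp add: lif_step_def)

lemma append_shrub_in_shrub_perms_iff:
  assumes \<sigma>: "\<sigma> permutes {1..3 * n}"
    and abc: "a \<le> 3 * n" "b \<le> Suc (3 * n)" "c \<le> Suc (Suc (3 * n))"
  shows "append_shrub (3 * n) (\<sigma>, a, b, c) \<in> shrub_perms_321 (Suc n) \<longleftrightarrow>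
     \<sigma> \<in> shrub_perms_321 n \<and> (a, b, c) \<in> shrub_choices (lif (3 * n) \<sigma>)"
proof -
  let ?\<pi> = "append_shrub (3 * n) (\<sigma>, a, b, c)"
  have old: "?\<pi> (3 * i + 1) < ?\<pi> (3 * i + 2) \<longleftrightarrow> \<sigma> (3 * i + 1) < \<sigma> (3 * i + 2)"
      "?\<pi> (3 * i + 1) < ?\<pi> (3 * i + 3) \<longleftrightarrow> \<sigma> (3 * i + 1) < \<sigma> (3 * i + 3)" if "i < n" for i
    using that by (intro append_shrub_less_iff[OF \<sigma> abc]; simp)+
  have "3 * Suc n = 3 * n + 3" by simp
  then have "?\<pi> \<in> shrub_perms_321 (Suc n) \<longleftrightarrow>
      avoids_321 (3 * n + 3) ?\<pi> \<and>
      (\<forall>i<n. \<sigma> (3 * i + 1) < \<sigma> (3 * i + 2) \<and> \<sigma> (3 * i + 1) < \<sigma> (3 * i + 3)) \<and>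
      ?\<pi> (3 * n + 1) < ?\<pi> (3 * n + 2) \<and> ?\<pi> (3 * n + 1) < ?\<pi> (3 * n + 3)"
    unfolding shrub_perms_321_def using append_shrub_permutes[OF \<sigma> abc] old by (auto simp only: mem_Collect_eq All_less_Suc)
  also have "\<dots> \<longleftrightarrow> \<sigma> \<in> shrub_perms_321 n \<and> (a, b, c) \<in> shrub_choices (lif (3 * n) \<sigma>)"
    unfolding append_shrub_root_less_fst[OF \<sigma> abc] avoids_321_append_shrub_iff[OF \<sigma> abc]
      shrub_choices_iff shrub_perms_321_def
    \<comment> \<open>\<open>le_lif_step\<close> turns \<open>b \<le> a\<close> and
      \<open>a \<le> lif (3 * n) \<sigma>\<close> into the avoidance bound on
      \<open>b\<close>.\<close>
    using \<sigma> append_shrub_root_less_snd[OF \<sigma> abc] le_lif_step[of a "lif (3 * n) \<sigma>"] by auto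
  finally show ?thesis .
qed

lemma shrub_choices_bounds:
  assumes "(a, b, c) \<in> shrub_choices k" "k \<le> N"
  shows "a \<le> N" "b \<le> Suc N" "c \<le> Suc (Suc N)"
  using assms by (auto simp: shrub_choices_iff)

text \<open>A generating tree: the children of \<open>\<sigma>\<close> are indexed by a set
  depending on \<open>\<sigma>\<close> only through its statistic. The bijection on all permutations
  restricts because membership is equivalent on both sides.\<close>

lemma bij_betw_append_shrub:
  "bij_betw (append_shrub (3 * n))
     (SIGMA \<sigma>:shrub_perms_321 n. shrub_choices (lif (3 * n) \<sigma>)) (shrub_perms_321 (Suc n))"
proof (rule bij_betwI')
  fix p q
  assume pq: "p \<in> (SIGMA \<sigma>:shrub_perms_321 n. shrub_choices (lif (3 * n) \<sigma>))"
    "q \<in> (SIGMA \<sigma>:shrub_perms_321 n. shrub_choices (lif (3 * n) \<sigma>))"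
  obtain \<sigma> a b c \<sigma>' a' b' c' where "p = (\<sigma>, a, b, c)" "q = (\<sigma>', a', b', c')"
    by (metis prod_cases4)
  with pq show "append_shrub (3 * n) p = append_shrub (3 * n) q \<longleftrightarrow> p = q"
    using append_shrub_inject[of \<sigma> "3 * n" a b c \<sigma>' a' b' c']
      shrub_choices_bounds[of a b c, OF _ lif_le] shrub_choices_bounds[of a' b' c', OF _ lif_le]
    by (auto simp: shrub_perms_321_def)
next
  fix p
  assume p: "p \<in> (SIGMA \<sigma>:shrub_perms_321 n. shrub_choices (lif (3 * n) \<sigma>))"
  obtain \<sigma> a b c where [simp]: "p = (\<sigma>, a, b, c)"
    by (metis prod_cases4)
  show "append_shrub (3 * n) p \<in> shrub_perms_321 (Suc n)"
    using p append_shrub_in_shrub_perms_iff[of \<sigma> n a b c] shrub_choices_bounds[of a b c, OF _ lif_le]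
    by (auto simp: shrub_perms_321_def)
next
  fix \<pi>
  assume \<pi>: "\<pi> \<in> shrub_perms_321 (Suc n)"
  then have "\<pi> permutes {1..3 * n + 3}"
    by (simp add: shrub_perms_321_def add.commute)
  then obtain \<sigma> a b c where \<sigma>: "\<sigma> permutes {1..3 * n}" "a \<le> 3 * n" "b \<le> Suc (3 * n)"
      "c \<le> Suc (Suc (3 * n))" and eq: "\<pi> = append_shrub (3 * n) (\<sigma>, a, b, c)"
    by (rule append_shrub_surj)
  then show "\<exists>p\<in>SIGMA \<sigma>:shrub_perms_321 n. shrub_choices (lif (3 * n) \<sigma>). \<pi> = append_shrub (3 * n) p"
    using \<pi> append_shrub_in_shrub_perms_iff[OF \<sigma>] by (intro bexI[where x = "(\<sigma>, a, b, c)"]) auto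
qed

section \<open>Recurrence for sums over shrub permutations\<close>

lemma finite_shrub_perms_321: "finite (shrub_perms_321 n)"
  by (rule finite_subset[OF _ finite_permutations[of "{1..3 * n}"]]) (auto simp: shrub_perms_321_def)

text \<open>The generating tree in summed form; \<open>f\<close> will be the weight
  \<open>u ^ k\<close> of the statistic \<open>k\<close>.\<close>

lemma sum_shrub_perms_Suc:
  fixes f :: "nat \<Rightarrow> 'a::comm_monoid_add"
  shows "(\<Sum>\<pi>\<in>shrub_perms_321 (Suc n). f (lif (3 * Suc n) \<pi>)) =
    (\<Sum>\<sigma>\<in>shrub_perms_321 n. \<Sum>p\<in>shrub_choices (lif (3 * n) \<sigma>). f (shrub_lif (lif (3 * n) \<sigma>) p))"
proof -
  have "(\<Sum>\<pi>\<in>shrub_perms_321 (Suc n). f (lif (3 * Suc n) \<pi>)) =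
      (\<Sum>q\<in>(SIGMA \<sigma>:shrub_perms_321 n. shrub_choices (lif (3 * n) \<sigma>)).
         f (lif (3 * Suc n) (append_shrub (3 * n) q)))"
    by (rule sum.reindex_bij_betw[OF bij_betw_append_shrub, symmetric])
  also have "\<dots> = (\<Sum>q\<in>(SIGMA \<sigma>:shrub_perms_321 n. shrub_choices (lif (3 * n) \<sigma>)).
         case q of (\<sigma>, p) \<Rightarrow> f (shrub_lif (lif (3 * n) \<sigma>) p))"
  proof (intro sum.cong refl)
    fix q
    assume q: "q \<in> (SIGMA \<sigma>:shrub_perms_321 n. shrub_choices (lif (3 * n) \<sigma>))"
    obtain \<sigma> a b c where [simp]: "q = (\<sigma>, a, b, c)"
      by (metis prod_cases4)
    have N: "3 * Suc n = 3 * n + 3" by simp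
    have "lif (3 * n + 3) (append_shrub (3 * n) q) = shrub_lif (lif (3 * n) \<sigma>) (a, b, c)"
      using q lif_append_shrub[of \<sigma> "3 * n" a b c] shrub_choices_bounds[of a b c, OF _ lif_le]
      by (auto simp: shrub_perms_321_def)
    then show "f (lif (3 * Suc n) (append_shrub (3 * n) q)) =
        (case q of (\<sigma>, p) \<Rightarrow> f (shrub_lif (lif (3 * n) \<sigma>) p))"
      unfolding N by simp
  qed
  also have "\<dots> = (\<Sum>\<sigma>\<in>shrub_perms_321 n. \<Sum>p\<in>shrub_choices (lif (3 * n) \<sigma>). f (shrub_lif (lif (3 * n) \<sigma>) p))"
    by (rule sum.Sigma[symmetric]) (auto simp: finite_shrub_perms_321 finite_shrub_choices)
  finally show ?thesis .
qed

section \<open>Coefficients of the generating function and of its derivatives\<close>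

lemma fps_nth_shrub_gf:
  "fps_nth shrub_gf n = (\<Sum>\<sigma>\<in>shrub_perms_321 n. monom 1 (lif (3 * n) \<sigma>))"
proof (rule poly_eqI)
  fix k
  have "coeff (\<Sum>\<sigma>\<in>shrub_perms_321 n. monom (1::rat) (lif (3 * n) \<sigma>)) k =
      (\<Sum>\<sigma>\<in>shrub_perms_321 n. if lif (3 * n) \<sigma> = k then 1 else 0)"
    by (simp add: coeff_sum)
  also have "\<dots> = of_nat (card {\<sigma> \<in> shrub_perms_321 n. lif (3 * n) \<sigma> = k})"
    by (simp add: finite_shrub_perms_321 flip: sum.inter_filter)
  finally show "coeff (fps_nth shrub_gf n) k =
      coeff (\<Sum>\<sigma>\<in>shrub_perms_321 n. monom 1 (lif (3 * n) \<sigma>)) k"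
    by (simp add: coeff_shrub_gf shrub_count_def)
qed

lemma to_fract_sum: "to_fract (\<Sum>x\<in>A. f x) = (\<Sum>x\<in>A. to_fract (f x))"
  by (induction A rule: infinite_finite_induct) auto

lemma to_fract_of_nat: "to_fract (of_nat n) = of_nat n"
  by (induction n) auto

lemma to_fract_power: "to_fract (p ^ n) = to_fract p ^ n"
  by (induction n) auto

lemma to_fract_monom_1: "to_fract (monom 1 k) = var_u ^ k"
  by (simp add: var_u_def monom_altdef to_fract_power)

lemma var_u_neq_1: "var_u \<noteq> 1"
proof
  assume "var_u = 1"
  then have "to_fract [:0, 1:] = to_fract (1 :: rat poly)"
    by (simp add: var_u_def)
  then show False
    by (simp only: to_fract_eq_iff) (simp add: one_pCons)
qed

lemma to_fract_const_of_nat: "to_fract [:of_nat k :: rat:] = of_nat k"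
  by (simp flip: to_fract_of_nat add: of_nat_poly)

lemma poly_1_sum_monom: "poly (\<Sum>x\<in>A. monom 1 (f x)) 1 = (of_nat (card A) :: rat)"
  by (simp add: poly_sum poly_monom)

lemma pderiv_sum: "pderiv (\<Sum>x\<in>A. f x) = (\<Sum>x\<in>A. pderiv (f x))"
  using higher_pderiv_sum[of 1] by simp

lemma poly_1_pderiv_sum_monom:
  "poly (pderiv (\<Sum>x\<in>A. monom 1 (f x))) 1 = (of_nat (\<Sum>x\<in>A. f x) :: rat)"
  by (simp add: pderiv_sum pderiv_monom poly_sum poly_monom)

text \<open>The second factorial moment. Truncated subtraction does no harm, since the factor
  \<open>f x\<close> vanishes when \<open>f x = 0\<close>.\<close>

lemma poly_1_pderiv_pderiv_sum_monom:
  "poly (pderiv (pderiv (\<Sum>x\<in>A. monom 1 (f x)))) 1 = (of_nat (\<Sum>x\<in>A. f x * (f x - 1)) :: rat)"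
  by (simp add: pderiv_sum pderiv_monom poly_sum poly_monom mult.commute)

section \<open>Closed form of the kernel\<close>

lemma sum_power_lif_step:
  fixes u :: "'a::comm_semiring_1"
  shows "(\<Sum>c\<le>m. u ^ lif_step k c) = u ^ Suc k + (\<Sum>c<m. u ^ Suc c)"
  by (simp add: sum.atMost_shift lif_step_def)

text \<open>The old statistic \<open>k\<close> enters an exponent only for
  \<open>a = b = c = 0\<close>; elsewhere it merely limits the range of \<open>a\<close>.\<close>

lemma sum_shrub_choices:
  fixes u :: "'a::comm_semiring_1"
  shows "(\<Sum>p\<in>shrub_choices k. u ^ shrub_lif k p) =
     u ^ (k + 3) + u + (\<Sum>a<k. \<Sum>m<a + 2. \<Sum>c<m + 2. u ^ Suc c)"
proof -
  define g where "g a b = (\<Sum>c\<le>min (Suc a) (lif_step (lif_step k a) b). u ^ lif_step (lif_step (lif_step k a) b) c)" for a b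
  have "(\<Sum>p\<in>shrub_choices k. u ^ shrub_lif k p) = (\<Sum>a\<le>k. \<Sum>b\<le>a. g a b)"
    unfolding g_def shrub_choices_def shrub_lif_def
    by (simp add: sum.Sigma split_def)
  also have "\<dots> = g 0 0 + (\<Sum>a<k. \<Sum>b\<le>Suc a. g (Suc a) b)"
    by (simp add: sum.atMost_shift)
  \<comment> \<open>\<open>a = 0\<close> forces \<open>b = 0\<close> and \<open>c \<le> 1\<close>:
    \<open>c = 0\<close> yields the statistic \<open>k + 3\<close>, and \<open>c = 1\<close> yields
    \<open>1\<close>.\<close>
  also have "g 0 0 = u ^ (k + 3) + u"
    unfolding g_def sum_power_lif_step by (simp add: lif_step_def eval_nat_numeral)
  also have "(\<Sum>a<k. \<Sum>b\<le>Suc a. g (Suc a) b) = (\<Sum>a<k. \<Sum>m<a + 2. \<Sum>c<m + 2. u ^ Suc c)"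
  proof (rule sum.cong[OF refl])
    \<comment> \<open>The choice \<open>b = 0\<close> gives the longest inner sum,
      \<open>m = a + 1\<close>; the choice \<open>b = Suc m\<close> gives the one for
      \<open>m \<le> a\<close>.\<close>
    fix a
    have "g (Suc a) 0 = (\<Sum>c<a + 3. u ^ Suc c)"
      unfolding g_def sum_power_lif_step by (simp add: lif_step_def eval_nat_numeral algebra_simps)
    moreover have "g (Suc a) (Suc b) = (\<Sum>c<b + 2. u ^ Suc c)" if "b < Suc a" for b
      unfolding g_def sum_power_lif_step using that by (simp add: lif_step_def algebra_simps min_def)
    ultimately show "(\<Sum>b\<le>Suc a. g (Suc a) b) = (\<Sum>m<a + 2. \<Sum>c<m + 2. u ^ Suc c)"
      by (simp add: sum.atMost_shift eval_nat_numeral algebra_simps del: sum.lessThan_Suc)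
        (simp add: algebra_simps)
  qed
  finally show ?thesis .
qed

lemma geometric_sum_Suc:
  fixes u :: "'a::comm_ring_1"
  shows "(1 - u) * (\<Sum>c<m. u ^ Suc c) = u - u ^ Suc m"
proof (induction m)
  case (Suc m)
  have 1: "(1 - u) * (\<Sum>c<Suc m. u ^ Suc c) = (1 - u) * (\<Sum>c<m. u ^ Suc c) + (1 - u) * u ^ Suc m"
    by (simp add: distrib_left)
  show ?case
    unfolding 1 Suc.IH by (simp add: algebra_simps)
qed simp

lemma geometric_sum_sum:
  fixes u :: "'a::comm_ring_1"
  shows "(1 - u)^2 * (\<Sum>m<a. \<Sum>c<m + 2. u ^ Suc c) = of_nat a * u * (1 - u) - u ^ 3 + u ^ (a + 3)"
proof (induction a)
  case (Suc a)
  have "(1 - u)^2 * (\<Sum>c<a + 2. u ^ Suc c) = (1 - u) * (u - u ^ (a + 3))"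
    using geometric_sum_Suc[of u "a + 2"] by (simp add: power2_eq_square mult.assoc eval_nat_numeral)
  then show ?case
    using Suc by (simp add: distrib_left eval_nat_numeral algebra_simps)
qed simp

text \<open>With the denominator \<open>2 * (1 - u)^3\<close> cleared, induction on \<open>k\<close>
  works in any commutative ring: passing to \<open>Suc k\<close> multiplies
  \<open>u ^ (k + 3)\<close> by \<open>u\<close> and adds the double sum for
  \<open>a = k\<close>.\<close>

lemma shrub_kernel_cleared:
  fixes u :: "'a::comm_ring_1"
  shows "2 * (1 - u)^3 * (u ^ (k + 3) + u + (\<Sum>a<k. \<Sum>m<a + 2. \<Sum>c<m + 2. u ^ Suc c)) =
    u * (2 * u^2 * (1 - 3 * u + 2 * u^2 - u^3) * u ^ k + 2 * (1 - 3 * u + 3 * u^2 - u^3 + u^4)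
      + 2 * (2 - 2 * u - u^2) * (1 - u) * of_nat k + (1 - u)^2 * of_nat (k * (k - 1)))"
proof (induction k)
  case (Suc k)
  have 1: "of_nat (Suc k * (Suc k - 1)) = of_nat (k * (k - 1)) + (2 * of_nat k :: 'a)"
    by (cases k) (simp_all add: algebra_simps)
  have 2: "2 * (1 - u)^3 * x = 2 * (1 - u) * ((1 - u)^2 * x)" for x
    by (simp only: power3_eq_cube power2_eq_square mult.assoc)
  have "2 * (1 - u)^3 * (\<Sum>m<k + 2. \<Sum>c<m + 2. u ^ Suc c) =
      2 * (1 - u) * (of_nat (k + 2) * u * (1 - u) - u ^ 3 + u ^ (k + 5))"
    unfolding 2 geometric_sum_sum by (simp add: add.commute)
  \<comment> \<open>This isolates the induction hypothesis, with \<open>y\<close> the power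
    \<open>u ^ (k + 3)\<close>, \<open>S\<close> the old triple sum and \<open>W\<close> the new
    double sum.\<close>
  moreover have "2 * q * (u * y + u + (S + W)) = 2 * q * (y + u + S) + 2 * q * (u - 1) * y + 2 * q * W"
    for q y S W :: 'a
    by (simp add: algebra_simps)
  moreover have "u ^ (Suc k + 3) = u * u ^ (k + 3)"
    by (simp only: add_Suc power_Suc)
  ultimately have "2 * (1 - u)^3 * (u ^ (Suc k + 3) + u + (\<Sum>a<Suc k. \<Sum>m<a + 2. \<Sum>c<m + 2. u ^ Suc c)) =
      2 * (1 - u)^3 * (u ^ (k + 3) + u + (\<Sum>a<k. \<Sum>m<a + 2. \<Sum>c<m + 2. u ^ Suc c))
      + 2 * (1 - u)^3 * (u - 1) * u ^ (k + 3)
      + 2 * (1 - u) * (of_nat (k + 2) * u * (1 - u) - u ^ 3 + u ^ (k + 5))"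
    by (simp only: sum.lessThan_Suc)
  then show ?case
    unfolding Suc.IH 1
    by (simp add: eval_nat_numeral algebra_simps)
qed (simp add: eval_nat_numeral algebra_simps)

lemma shrub_kernel:
  fixes u :: "'a::field"
  assumes "u \<noteq> 1" "(2::'a) \<noteq> 0"
  shows "(\<Sum>p\<in>shrub_choices k. u ^ shrub_lif k p) =
    u / (1 - u) * (u^2 * (1 - 3 * u + 2 * u^2 - u^3) / (1 - u)^2 * u ^ k
      + (1 - 3 * u + 3 * u^2 - u^3 + u^4) / (1 - u)^2
      + (2 - 2 * u - u^2) / (1 - u) * of_nat k + 1 / 2 * of_nat (k * (k - 1)))"
proof -
  \<comment> \<open>Keeping \<open>1 - u\<close> as an atom \<open>q\<close> leaves only
    cancellation of denominators to the simplifier.\<close>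
  define q where "q = 1 - u"
  have q: "q \<noteq> 0" using assms by (simp add: q_def)
  have "2 * q ^ 3 * (\<Sum>p\<in>shrub_choices k. u ^ shrub_lif k p) =
    2 * q ^ 3 * (u / q * (u^2 * (1 - 3 * u + 2 * u^2 - u^3) / q^2 * u ^ k
      + (1 - 3 * u + 3 * u^2 - u^3 + u^4) / q^2
      + (2 - 2 * u - u^2) / q * of_nat k + 1 / 2 * of_nat (k * (k - 1))))"
    unfolding sum_shrub_choices q_def shrub_kernel_cleared
    unfolding q_def[symmetric]
    using q assms(2)
    by (simp add: divide_simps eval_nat_numeral del: of_nat_mult)
  moreover have "2 * q ^ 3 \<noteq> 0"
    using q assms(2) by simp
  ultimately show ?thesis
    unfolding q_def using mult_left_cancel by blast
qed

section \<open>The functional equation, coefficient by coefficient in \<open>x\<close>\<close>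

theorem theorem16:
  fixes u :: "rat poly fract"
  defines "u \<equiv> var_u"
  shows "to_ratfun shrub_gf =
    1 + fps_X * fps_const (u / (1 - u)) *
      (fps_const (u^2 * (1 - 3 * u + 2 * u^2 - u^3) / (1 - u)^2) * to_ratfun shrub_gf
       + fps_const ((1 - 3 * u + 3 * u^2 - u^3 + u^4) / (1 - u)^2) * to_ratfun (at_u_1 shrub_gf)
       + fps_const ((2 - 2 * u - u^2) / (1 - u)) * to_ratfun (at_u_1 (deriv_u shrub_gf))
       + fps_const (1 / 2) * to_ratfun (at_u_1 (deriv_u (deriv_u shrub_gf))))"
    (is "_ = 1 + fps_X * fps_const ?q * ?R")
proof (rule fps_ext)
  fix n
  have u: "u \<noteq> 1"
    unfolding u_def by (rule var_u_neq_1)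
  \<comment> \<open>The coefficient \<open>1 / 2\<close> calls for \<open>2 \<noteq> 0\<close> in
    the fraction field, inherited from the polynomials through the injective
    \<open>to_fract\<close>.\<close>
  have "(of_nat 2 :: rat poly) \<noteq> 0"
    by simp
  then have "to_fract (of_nat 2 :: rat poly) \<noteq> 0"
    by (simp only: to_fract_eq_0_iff not_False_eq_True)
  then have two: "(2 :: rat poly fract) \<noteq> 0"
    by (simp only: to_fract_of_nat of_nat_numeral not_False_eq_True)
  have H: "fps_nth (to_ratfun shrub_gf) m = (\<Sum>\<sigma>\<in>shrub_perms_321 m. u ^ lif (3 * m) \<sigma>)" for m
    by (simp add: to_ratfun_def fps_map_def fps_nth_shrub_gf to_fract_sum to_fract_monom_1 u_def)
  have H1: "fps_nth (to_ratfun (at_u_1 shrub_gf)) m = (\<Sum>\<sigma>\<in>shrub_perms_321 m. 1)" for m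
    by (simp add: to_ratfun_def at_u_1_def fps_map_def fps_nth_shrub_gf poly_1_sum_monom
        to_fract_const_of_nat)
  have H2: "fps_nth (to_ratfun (at_u_1 (deriv_u shrub_gf))) m =
      (\<Sum>\<sigma>\<in>shrub_perms_321 m. of_nat (lif (3 * m) \<sigma>))" for m
    by (simp only: to_ratfun_def at_u_1_def deriv_u_def fps_map_def fps_nth_Abs_fps
        fps_nth_shrub_gf poly_1_pderiv_sum_monom to_fract_const_of_nat) (rule of_nat_sum)
  have H3: "fps_nth (to_ratfun (at_u_1 (deriv_u (deriv_u shrub_gf)))) m =
      (\<Sum>\<sigma>\<in>shrub_perms_321 m. of_nat (lif (3 * m) \<sigma> * (lif (3 * m) \<sigma> - 1)))" for m
    by (simp only: to_ratfun_def at_u_1_def deriv_u_def fps_map_def fps_nth_Abs_fps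
        fps_nth_shrub_gf poly_1_pderiv_pderiv_sum_monom to_fract_const_of_nat) (rule of_nat_sum)
  show "fps_nth (to_ratfun shrub_gf) n = fps_nth (1 + fps_X * fps_const ?q * ?R) n"
  proof (cases n)
    case 0
    \<comment> \<open>The empty forest is the identity with statistic \<open>0\<close> and
      contributes \<open>u ^ 0 = 1\<close>.\<close>
    have "shrub_perms_321 0 = {id}"
      by (auto simp: shrub_perms_321_def avoids_321_def)
    then show ?thesis
      using 0 by (simp add: H lif_def mult.assoc)
  next
    case (Suc m)
    have "fps_nth (to_ratfun shrub_gf) (Suc m) =
        (\<Sum>\<sigma>\<in>shrub_perms_321 m. \<Sum>p\<in>shrub_choices (lif (3 * m) \<sigma>). u ^ shrub_lif (lif (3 * m) \<sigma>) p)"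
      unfolding H by (rule sum_shrub_perms_Suc)
    \<comment> \<open>The kernel is linear in \<open>u ^ k\<close>, \<open>1\<close>,
      \<open>k\<close> and \<open>k * (k - 1)\<close>, so summing it over \<open>\<sigma>\<close>
      produces the four coefficients \<open>H\<close>, \<open>H1\<close>, \<open>H2\<close>,
      \<open>H3\<close>.\<close>
    also have "\<dots> = ?q * fps_nth ?R m"
      unfolding shrub_kernel[OF u two] fps_add_nth fps_mult_left_const_nth H H1 H2 H3
      by (simp only: sum_distrib_left sum.distrib distrib_left mult_1_right)
    also have "\<dots> = fps_nth (1 + fps_X * fps_const ?q * ?R) (Suc m)"
      by (simp add: mult.assoc)
    finally show ?thesis
      using Suc by simp
  qed
qed

end
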